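(* Let $\varphi:P\to Q$ be an order-preserving map between finite posets and let $X:Q\to\mathcal{P}_{<\infty}$ be a diagram of finite posets. If $\varphi^{-1}(F_q)$ is homotopically trivial for every $q\in Q$, where $F_q=\{r\in Q: r\ge q\}$, then the canonical map $\operatorname{\underline{hocolim}}\varphi^*X\to\operatorname{\underline{hocolim}} X$ is a weak equivalence.
   Context: Posets are viewed as categories with a unique arrow $p\to q$ iff $p\le q$; $\mathcal{P}_{<\infty}$ is the category of finite posets and order-preserving maps. Write $X_q=X(q)$, $f_{qq'}=X(q\to q')$. $\operatorname{\underline{hocolim}} X$ is the poset on $\coprod_{q}X_q$ keeping the order within each $X_q$ and, for $x\in X_q$, $y\in X_{q'}$, $q\le q'$, setting $x\le y$ iff $f_{qq'}(x)\le y$ in $X_{q'}$. $\varphi^*X=X\circ\varphi$ is the pulled-back $P$-diagram, and the canonical map $\operatorname{\underline{hocolim}}\varphi^*X\to\operatorname{\underline{hocolim}} X$ is induced by the identities $(\varphi^*X)_p=X_{\varphi(p)}$. A finite poset is homotopically trivial if its order complex is contractible. Finite posets are finite topological spaces with the down-sets as open sets; a weak equivalence is a continuous map inducing isomorphisms on all homotopy groups (equivalently its map on order complexes is a homotopy equivalence). *)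

theory Defs
  imports "HOL-Analysis.Analysis"
begin

definition fin_poset :: "'a set \<Rightarrow> ('a \<Rightarrow> 'a \<Rightarrow> bool) \<Rightarrow> bool" where
  "fin_poset A le \<longleftrightarrow> finite A \<and>
     (\<forall>x\<in>A. le x x) \<and>
     (\<forall>x\<in>A. \<forall>y\<in>A. le x y \<and> le y x \<longrightarrow> x = y) \<and>
     (\<forall>x\<in>A. \<forall>y\<in>A. \<forall>z\<in>A. le x y \<and> le y z \<longrightarrow> le x z)"

definition order_preserving ::
  "'a set \<Rightarrow> ('a \<Rightarrow> 'a \<Rightarrow> bool) \<Rightarrow> 'b set \<Rightarrow> ('b \<Rightarrow> 'b \<Rightarrow> bool) \<Rightarrow> ('a \<Rightarrow> 'b) \<Rightarrow> bool" where
  "order_preserving A leA B leB g \<longleftrightarrow>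
     (\<forall>x\<in>A. g x \<in> B) \<and> (\<forall>x\<in>A. \<forall>y\<in>A. leA x y \<longrightarrow> leB (g x) (g y))"

definition is_chain :: "'a set \<Rightarrow> ('a \<Rightarrow> 'a \<Rightarrow> bool) \<Rightarrow> bool" where
  "is_chain C le \<longleftrightarrow> (\<forall>x\<in>C. \<forall>y\<in>C. le x y \<or> le y x)"

(* Geometric realisation of the order complex of (A, le): functions A \<rightarrow> [0,1]
   (extensional on A) summing to 1 whose support is a chain, with the topology
   induced from the product topology on A \<rightarrow> \<real>. *)
definition order_complex :: "'a set \<Rightarrow> ('a \<Rightarrow> 'a \<Rightarrow> bool) \<Rightarrow> ('a \<Rightarrow> real) topology" where
  "order_complex A le = subtopology (powertop_real A)
     {w \<in> extensional A. (\<forall>a\<in>A. 0 \<le> w a) \<and> (\<Sum>a\<in>A. w a) = 1 \<and>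
        is_chain {a\<in>A. w a \<noteq> 0} le}"

(* Simplicial (affine) map on order complexes induced by an order-preserving map g. *)
definition realize_map :: "'a set \<Rightarrow> 'b set \<Rightarrow> ('a \<Rightarrow> 'b) \<Rightarrow> ('a \<Rightarrow> real) \<Rightarrow> ('b \<Rightarrow> real)" where
  "realize_map A B g w = (\<lambda>b\<in>B. \<Sum>a\<in>{a\<in>A. g a = b}. w a)"

definition homotopy_equivalence_map ::
  "'a topology \<Rightarrow> 'b topology \<Rightarrow> ('a \<Rightarrow> 'b) \<Rightarrow> bool" where
  "homotopy_equivalence_map S T f \<longleftrightarrow> continuous_map S T f \<and>
     (\<exists>g. continuous_map T S g \<and>
          homotopic_with (\<lambda>x. True) S S (g \<circ> f) id \<and>
          homotopic_with (\<lambda>x. True) T T (f \<circ> g) id)"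

definition homotopically_trivial :: "'a set \<Rightarrow> ('a \<Rightarrow> 'a \<Rightarrow> bool) \<Rightarrow> bool" where
  "homotopically_trivial A le \<longleftrightarrow>
     topspace (order_complex A le) \<noteq> {} \<and> contractible_space (order_complex A le)"

(* Weak equivalence of finite posets (as finite spaces): the induced map of
   order complexes is a homotopy equivalence. *)
definition weak_equivalence ::
  "'a set \<Rightarrow> ('a \<Rightarrow> 'a \<Rightarrow> bool) \<Rightarrow> 'b set \<Rightarrow> ('b \<Rightarrow> 'b \<Rightarrow> bool) \<Rightarrow> ('a \<Rightarrow> 'b) \<Rightarrow> bool" where
  "weak_equivalence A leA B leB g \<longleftrightarrow>
     order_preserving A leA B leB g \<and>
     homotopy_equivalence_map (order_complex A leA) (order_complex B leB) (realize_map A B g)"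

definition poset_diagram ::
  "'q set \<Rightarrow> ('q \<Rightarrow> 'q \<Rightarrow> bool) \<Rightarrow> ('q \<Rightarrow> 'x set) \<Rightarrow> ('q \<Rightarrow> 'x \<Rightarrow> 'x \<Rightarrow> bool)
    \<Rightarrow> ('q \<Rightarrow> 'q \<Rightarrow> 'x \<Rightarrow> 'x) \<Rightarrow> bool" where
  "poset_diagram Q leQ X leX f \<longleftrightarrow>
     (\<forall>q\<in>Q. fin_poset (X q) (leX q)) \<and>
     (\<forall>q\<in>Q. \<forall>q'\<in>Q. leQ q q' \<longrightarrow> order_preserving (X q) (leX q) (X q') (leX q') (f q q')) \<and>
     (\<forall>q\<in>Q. \<forall>x\<in>X q. f q q x = x) \<and>
     (\<forall>q\<in>Q. \<forall>q'\<in>Q. \<forall>q''\<in>Q. leQ q q' \<and> leQ q' q'' \<longrightarrow>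
         (\<forall>x\<in>X q. f q' q'' (f q q' x) = f q q'' x))"

(* Underlying set and order of hocolim X (Grothendieck construction). *)
definition hocolim_set :: "'q set \<Rightarrow> ('q \<Rightarrow> 'x set) \<Rightarrow> ('q \<times> 'x) set" where
  "hocolim_set Q X = Sigma Q X"

definition hocolim_le ::
  "('q \<Rightarrow> 'q \<Rightarrow> bool) \<Rightarrow> ('q \<Rightarrow> 'x \<Rightarrow> 'x \<Rightarrow> bool) \<Rightarrow> ('q \<Rightarrow> 'q \<Rightarrow> 'x \<Rightarrow> 'x)
    \<Rightarrow> ('q \<times> 'x) \<Rightarrow> ('q \<times> 'x) \<Rightarrow> bool" where
  "hocolim_le leQ leX f a b \<longleftrightarrow> leQ (fst a) (fst b) \<and> leX (fst b) (f (fst a) (fst b) (snd a)) (snd b)"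

definition up_set :: "'q set \<Rightarrow> ('q \<Rightarrow> 'q \<Rightarrow> bool) \<Rightarrow> 'q \<Rightarrow> 'q set" where
  "up_set Q leQ q = {r\<in>Q. leQ q r}"

end

theory Submission
  imports Defs
begin

text \<open>
  Over \<open>(q, x)\<close> the canonical map has upper fibre
  \<open>{(p, y). q \<le> \<phi> p \<and> f q (\<phi> p) x \<le> y}\<close>. The maps \<open>p \<mapsto> (p, f q (\<phi> p) x)\<close> and \<open>(p, y) \<mapsto> p\<close> form a
  Galois connection between the preimage of the up-set of \<open>q\<close> under \<open>\<phi>\<close> and this fibre. Comparable
  monotone maps are homotopic, so all upper fibres are contractible and Quillen's fibre lemma applies.

  The fibre lemma comes from contractible carriers. Let \<open>C\<close> assign to each element of a finite poset
  \<open>B\<close> a contractible subspace of \<open>Y\<close>, antitonically. Then there is a map from the order complex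
  of \<open>B\<close> to \<open>Y\<close> sending the complex of each up-set of \<open>b\<close> into \<open>C b\<close>, and it is unique up to
  homotopy. Such maps are extended over one element at a time, from the top downwards: adding \<open>b\<close>
  attaches a cone over the complex of the elements above \<open>b\<close>, and the map on the base of the cone
  already lands in the contractible space \<open>C b\<close>. For uniqueness, place the two given maps over the
  two maximal elements of the poset \<open>{None, Some True, Some False}\<close> with least element \<open>None\<close>, and
  extend them over the product of \<open>B\<close> with this poset, where all the inclusions of \<open>B\<close> are homotopic.
\<close>

subsection \<open>Extending maps into contractible spaces\<close>

lemma continuous_map_closed_pasting:
  assumes "closedin X S" "closedin X T" "topspace X \<subseteq> S \<union> T"
    and "continuous_map (subtopology X S) Y f" "continuous_map (subtopology X T) Y g"
    and "\<And>x. x \<in> S \<Longrightarrow> x \<in> T \<Longrightarrow> f x = g x"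
  shows "continuous_map X Y (\<lambda>x. if x \<in> S then f x else g x)"
proof (rule pasting_lemma_closed[where I = "UNIV :: bool set" and
      T = "\<lambda>i. if i then S else T" and f = "\<lambda>i. if i then f else g"])
  show "\<exists>j. j \<in> UNIV \<and> x \<in> (if j then S else T) \<and>
      (if x \<in> S then f x else g x) = (if j then f else g) x" if "x \<in> topspace X" for x
    using that assms(3) by (intro exI[of _ "x \<in> S"]) auto
qed (use assms in \<open>auto split: if_splits\<close>)

lemma contractible_space_contractionE:
  assumes "contractible_space Y" "topspace Y \<noteq> {}"
  obtains a c where "a \<in> topspace Y" "continuous_map (prod_topology (top_of_set {0..1::real}) Y) Y c"
    "\<And>y. c (0, y) = y" "\<And>y. c (1, y) = a"
proof -
  obtain a where a: "homotopic_with (\<lambda>x. True) Y Y id (\<lambda>x. a)"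
    using assms(1) by (auto simp: contractible_space_def)
  from homotopic_with_imp_continuous_maps[OF a] have "a \<in> topspace Y"
    using assms(2) by (auto simp: continuous_map_def Pi_iff)
  with a that show ?thesis
    by (auto simp: homotopic_with_def)
qed

lemma contractible_space_extension_from_sublevel:
  assumes Y: "contractible_space Y" "topspace Y \<noteq> {}"
    and u: "continuous_map X euclideanreal u" and u_nonneg: "\<And>x. x \<in> topspace X \<Longrightarrow> 0 \<le> u x"
    and h: "continuous_map (subtopology X {x \<in> topspace X. u x \<le> 1/2}) Y h"
  obtains H where "continuous_map X Y H" "\<And>x. u x = 0 \<Longrightarrow> H x = h x"
proof -
  obtain a c where a: "a \<in> topspace Y"
    and c: "continuous_map (prod_topology (top_of_set {0..1::real}) Y) Y c"
    and c0: "\<And>y. c (0, y) = y" and c1: "\<And>y. c (1, y) = a"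
    using contractible_space_contractionE[OF Y] by blast
  let ?N = "subtopology X {x \<in> topspace X. u x \<le> 1/2}"
  define H where "H = (\<lambda>x. if u x \<le> 1/2 then c (2 * u x, h x) else a)"
  have "continuous_map ?N (top_of_set {0..1}) (\<lambda>x. 2 * u x)"
    using u_nonneg by (intro continuous_map_into_subtopology continuous_intros
        continuous_map_from_subtopology[OF u]) auto
  from continuous_map_compose[OF continuous_map_pairedI[OF this h] c]
  have contraction: "continuous_map ?N Y (\<lambda>x. c (2 * u x, h x))"
    by (simp add: o_def)
  have "c (2 * u x, h x) = a" if "u x = 1/2" for x
  proof -
    have "2 * u x = 1" using that by simp
    then show ?thesis by (simp only: c1)
  qed
  with contraction have "continuous_map X Y H"
    unfolding H_def by (intro continuous_map_cases_le) (use u a in auto)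
  moreover have "H x = h x" if "u x = 0" for x
    using that c0 by (simp add: H_def)
  ultimately show ?thesis using that by blast
qed

lemma contractible_space_extension:
  assumes X: "normal_space X" "closedin X S" "openin X U"
    and retract: "S retract_of_space subtopology X U"
    and Y: "contractible_space Y" "topspace Y \<noteq> {}"
    and h: "continuous_map (subtopology X S) Y h"
  obtains H where "continuous_map X Y H" "\<And>x. x \<in> S \<Longrightarrow> H x = h x"
proof -
  obtain r where SU: "S \<subseteq> U" and r: "continuous_map (subtopology X U) (subtopology X S) r"
    and r_id: "\<And>x. x \<in> S \<Longrightarrow> r x = x"
    using retract by (auto simp: retract_of_space_def subtopology_subtopology inf_absorb2)
  have "disjnt S (topspace X - U)" "closedin X (topspace X - U)"
    using SU X(3) by (auto simp: disjnt_def)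
  then obtain u where u: "continuous_map X (top_of_set {0..1::real}) u"
    and uS: "u ` S \<subseteq> {0}" and uU: "u ` (topspace X - U) \<subseteq> {1}"
    using Urysohn_lemma[OF X(1,2), of "topspace X - U" 0 1] by auto
  have u_real: "continuous_map X euclideanreal u" and u_nonneg: "\<And>x. x \<in> topspace X \<Longrightarrow> 0 \<le> u x"
    using u by (auto simp: continuous_map_in_subtopology)
  have "{x \<in> topspace X. u x \<le> 1/2} \<subseteq> U"
    using uU by fastforce
  from continuous_map_compose[OF continuous_map_from_subtopology_mono[OF r this] h]
  obtain H where H: "continuous_map X Y H" and H_eq: "\<And>x. u x = 0 \<Longrightarrow> H x = (h \<circ> r) x"
    using contractible_space_extension_from_sublevel[OF Y u_real u_nonneg] by blast
  have "H x = h x" if "x \<in> S" for x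
    using H_eq[of x] uS that r_id by auto
  with H that show ?thesis by blast
qed

subsection \<open>Finite posets\<close>

lemma fin_poset_finite: "fin_poset A le \<Longrightarrow> finite A"
  by (simp add: fin_poset_def)

lemma fin_poset_refl: "fin_poset A le \<Longrightarrow> a \<in> A \<Longrightarrow> le a a"
  by (simp add: fin_poset_def)

lemma fin_poset_antisym:
  "fin_poset A le \<Longrightarrow> a \<in> A \<Longrightarrow> b \<in> A \<Longrightarrow> le a b \<Longrightarrow> le b a \<Longrightarrow> a = b"
  unfolding fin_poset_def by metis

lemma fin_poset_trans:
  "fin_poset A le \<Longrightarrow> a \<in> A \<Longrightarrow> b \<in> A \<Longrightarrow> c \<in> A \<Longrightarrow> le a b \<Longrightarrow> le b c \<Longrightarrow> le a c"
  unfolding fin_poset_def by metis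

lemma fin_poset_subset: "fin_poset A le \<Longrightarrow> U \<subseteq> A \<Longrightarrow> fin_poset U le"
  unfolding fin_poset_def by (meson finite_subset subset_iff)

lemma fin_poset_maximal:
  assumes A: "fin_poset A le" and U: "U \<subseteq> A" "U \<noteq> {}"
  obtains m where "m \<in> U" "\<And>a. a \<in> U \<Longrightarrow> le m a \<Longrightarrow> a = m"
proof -
  let ?less = "\<lambda>a b. le a b \<and> a \<noteq> b"
  note U_poset = fin_poset_subset[OF A U(1)]
  have asym: "asymp_on U ?less"
    using fin_poset_antisym[OF U_poset] by (intro asymp_onI) blast
  have trans: "transp_on U ?less"
    using fin_poset_antisym[OF U_poset] fin_poset_trans[OF U_poset] by (intro transp_onI) metis
  from Finite_Set.bex_max_element[OF fin_poset_finite[OF U_poset] asym trans U(2)]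
  show ?thesis using that by blast
qed

lemma fin_poset_chain_least:
  assumes A: "fin_poset A le" and U: "U \<subseteq> A" "U \<noteq> {}" and chain: "is_chain U le"
  obtains m where "m \<in> U" "\<And>a. a \<in> U \<Longrightarrow> le m a"
proof -
  note U_poset = fin_poset_subset[OF A U(1)]
  have trans: "transp_on U le"
    using fin_poset_trans[OF U_poset] by (intro transp_onI)
  have total: "totalp_on U le"
    using chain by (auto simp: totalp_on_def is_chain_def)
  from Finite_Set.bex_least_element[OF fin_poset_finite[OF U_poset] U(2) trans total]
  show ?thesis using that fin_poset_refl[OF U_poset] by metis
qed

lemma order_preserving_mem: "order_preserving A leA B leB g \<Longrightarrow> a \<in> A \<Longrightarrow> g a \<in> B"
  by (simp add: order_preserving_def)

lemma order_preserving_le: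
  "order_preserving A leA B leB g \<Longrightarrow> a \<in> A \<Longrightarrow> a' \<in> A \<Longrightarrow> leA a a' \<Longrightarrow> leB (g a) (g a')"
  by (simp add: order_preserving_def)

lemma order_preserving_up_set:
  assumes "order_preserving A leA B leB g" "a \<in> A" "a' \<in> up_set A leA a"
  shows "g a' \<in> up_set B leB (g a)"
  using assms by (simp add: order_preserving_def up_set_def)

lemma up_set_self: "fin_poset A le \<Longrightarrow> a \<in> A \<Longrightarrow> a \<in> up_set A le a"
  by (simp add: up_set_def fin_poset_refl)

lemma up_set_antimono:
  assumes "fin_poset A le" "a \<in> A" "b \<in> A" "le a b"
  shows "up_set A le b \<subseteq> up_set A le a"
  using fin_poset_trans[OF assms(1-3) _ assms(4)] by (auto simp: up_set_def)

definition up_closed :: "'a set \<Rightarrow> ('a \<Rightarrow> 'a \<Rightarrow> bool) \<Rightarrow> 'a set \<Rightarrow> bool" where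
  "up_closed A le U \<longleftrightarrow> U \<subseteq> A \<and> (\<forall>a\<in>U. up_set A le a \<subseteq> U)"

lemma up_closed_induct [consumes 2, case_names base insert]:
  assumes A: "fin_poset A le" and V: "up_closed A le V"
    and base: "P V"
    and insert: "\<And>U b. up_closed A le U \<Longrightarrow> V \<subseteq> U \<Longrightarrow> b \<in> A - U \<Longrightarrow> up_set A le b \<subseteq> insert b U \<Longrightarrow>
      P U \<Longrightarrow> P (insert b U)"
  shows "P A"
proof -
  have "P A" if "up_closed A le U" "V \<subseteq> U" "P U" for U
    using that
  proof (induction "card (A - U)" arbitrary: U rule: less_induct)
    case less
    have U: "U \<subseteq> A" using less.prems(1) by (simp add: up_closed_def)
    show ?case
    proof (cases "U = A")
      case False
      then obtain b where b: "b \<in> A - U" and max: "\<And>a. a \<in> A - U \<Longrightarrow> le b a \<Longrightarrow> a = b"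
        using fin_poset_maximal[OF A, of "A - U"] U by blast
      have up: "up_set A le b \<subseteq> insert b U"
        using max by (auto simp: up_set_def)
      have "card (A - insert b U) < card (A - U)"
        using b fin_poset_finite[OF A] by (intro psubset_card_mono) auto
      moreover have "up_closed A le (insert b U)"
        using less.prems(1) b up by (auto simp: up_closed_def)
      moreover have "P (insert b U)" using insert[OF less.prems(1,2) b up less.prems(3)] .
      ultimately show ?thesis using less.hyps less.prems(2) by blast
    qed (use less.prems in simp)
  qed
  with V base show ?thesis by blast
qed

definition prod_le :: "('a \<Rightarrow> 'a \<Rightarrow> bool) \<Rightarrow> ('b \<Rightarrow> 'b \<Rightarrow> bool) \<Rightarrow> 'a \<times> 'b \<Rightarrow> 'a \<times> 'b \<Rightarrow> bool" where
  "prod_le leA leB x y \<longleftrightarrow> leA (fst x) (fst y) \<and> leB (snd x) (snd y)"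

lemma fin_poset_prod:
  assumes "fin_poset A leA" "fin_poset B leB"
  shows "fin_poset (A \<times> B) (prod_le leA leB)"
  unfolding fin_poset_def[of "A \<times> B"]
proof (intro conjI ballI impI)
  show "finite (A \<times> B)" using assms by (simp add: fin_poset_finite)
  show "prod_le leA leB x x" if "x \<in> A \<times> B" for x
    using that assms by (auto simp: prod_le_def fin_poset_refl)
  show "x = y" if "x \<in> A \<times> B" "y \<in> A \<times> B" "prod_le leA leB x y \<and> prod_le leA leB y x" for x y
    using that fin_poset_antisym[OF assms(1)] fin_poset_antisym[OF assms(2)]
    by (simp add: prod_le_def prod_eq_iff mem_Times_iff)
  show "prod_le leA leB x z" if "x \<in> A \<times> B" "y \<in> A \<times> B" "z \<in> A \<times> B"
    "prod_le leA leB x y \<and> prod_le leA leB y z" for x y z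
    using that fin_poset_trans[OF assms(1), of "fst x" "fst y" "fst z"]
      fin_poset_trans[OF assms(2), of "snd x" "snd y" "snd z"]
    by (simp add: prod_le_def mem_Times_iff)
qed

definition flat_le :: "'i option \<Rightarrow> 'i option \<Rightarrow> bool" where
  "flat_le i j \<longleftrightarrow> i = None \<or> i = j"

lemma fin_poset_flat: "fin_poset (UNIV :: 'i::finite option set) flat_le"
  by (auto simp: fin_poset_def flat_le_def)

lemma order_preserving_fst: "order_preserving (A \<times> I) (prod_le leA leI) A leA fst"
  by (auto simp: order_preserving_def prod_le_def)

subsection \<open>Order complexes and their full subcomplexes\<close>

lemma topspace_order_complex:
  "topspace (order_complex A le) = {w \<in> extensional A. (\<forall>a\<in>A. 0 \<le> w a) \<and> (\<Sum>a\<in>A. w a) = 1 \<and>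
        is_chain {a\<in>A. w a \<noteq> 0} le}"
  by (auto simp: order_complex_def PiE_def)

lemma order_complexI:
  assumes "w \<in> extensional A" "\<And>a. a \<in> A \<Longrightarrow> 0 \<le> w a" "(\<Sum>a\<in>A. w a) = 1"
    and "\<And>a a'. a \<in> A \<Longrightarrow> a' \<in> A \<Longrightarrow> w a \<noteq> 0 \<Longrightarrow> w a' \<noteq> 0 \<Longrightarrow> le a a' \<or> le a' a"
  shows "w \<in> topspace (order_complex A le)"
  using assms by (simp add: topspace_order_complex is_chain_def)

lemma
  assumes "w \<in> topspace (order_complex A le)"
  shows order_complex_extensional: "w \<in> extensional A"
    and order_complex_nonneg: "a \<in> A \<Longrightarrow> 0 \<le> w a"
    and order_complex_sum: "(\<Sum>a\<in>A. w a) = 1"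
    and order_complex_chain: "is_chain {a\<in>A. w a \<noteq> 0} le"
    and order_complex_comparable:
      "a \<in> A \<Longrightarrow> a' \<in> A \<Longrightarrow> w a \<noteq> 0 \<Longrightarrow> w a' \<noteq> 0 \<Longrightarrow> le a a' \<or> le a' a"
  using assms by (simp_all add: topspace_order_complex is_chain_def)

lemma continuous_map_into_order_complex:
  "continuous_map Z (order_complex A le) F \<longleftrightarrow>
     F \<in> topspace Z \<rightarrow> topspace (order_complex A le) \<and>
     (\<forall>a\<in>A. continuous_map Z euclideanreal (\<lambda>z. F z a))"
  unfolding topspace_order_complex
  by (auto simp: order_complex_def continuous_map_in_subtopology continuous_map_componentwise)

lemma continuous_map_order_complex_coordinate:
  "a \<in> A \<Longrightarrow> continuous_map (order_complex A le) euclideanreal (\<lambda>w. w a)"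
  using continuous_map_into_order_complex[of "order_complex A le" A le id] by auto

lemma metrizable_space_order_complex: "finite A \<Longrightarrow> metrizable_space (order_complex A le)"
  unfolding order_complex_def
  by (intro metrizable_space_subtopology)
    (auto simp: metrizable_space_product_topology metrizable_space_euclidean intro: countable_finite)

text \<open>Restricting to a subset is modelled inside the ambient complex, since points of
  \<^term>\<open>order_complex U le\<close> are extensional on \<^term>\<open>U\<close> and hence not points of
  \<^term>\<open>order_complex A le\<close>.\<close>

definition full_subcomplex :: "'a set \<Rightarrow> ('a \<Rightarrow> 'a \<Rightarrow> bool) \<Rightarrow> 'a set \<Rightarrow> ('a \<Rightarrow> real) set" where
  "full_subcomplex A le U = {w \<in> topspace (order_complex A le). \<forall>a\<in>A. w a \<noteq> 0 \<longrightarrow> a \<in> U}"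

lemma full_subcomplex_subset_topspace: "full_subcomplex A le U \<subseteq> topspace (order_complex A le)"
  by (auto simp: full_subcomplex_def)

lemma full_subcomplex_mono: "U \<subseteq> V \<Longrightarrow> full_subcomplex A le U \<subseteq> full_subcomplex A le V"
  by (auto simp: full_subcomplex_def)

lemma full_subcomplex_Int:
  "full_subcomplex A le U \<inter> full_subcomplex A le V = full_subcomplex A le (U \<inter> V)"
  by (auto simp: full_subcomplex_def)

lemma full_subcomplex_self [simp]: "full_subcomplex A le A = topspace (order_complex A le)"
  by (auto simp: full_subcomplex_def)

lemma full_subcomplex_empty [simp]: "full_subcomplex A le {} = {}"
  by (auto simp: full_subcomplex_def topspace_order_complex)

lemma topspace_full_subcomplex:
  "topspace (subtopology (order_complex A le) (full_subcomplex A le U)) = full_subcomplex A le U"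
  using full_subcomplex_subset_topspace[of A le U] by auto

lemma closedin_full_subcomplex: "closedin (order_complex A le) (full_subcomplex A le U)"
proof -
  let ?K = "order_complex A le"
  have "full_subcomplex A le U = topspace ?K \<inter> \<Inter> ((\<lambda>a. {w \<in> topspace ?K. w a \<in> {0}}) ` (A - U))"
    by (auto simp: full_subcomplex_def)
  moreover have "closedin ?K {w \<in> topspace ?K. w a \<in> {0}}" if "a \<in> A" for a
    by (rule closedin_continuous_map_preimage[OF continuous_map_order_complex_coordinate[OF that]]) simp
  ultimately show ?thesis
    by (cases "A - U = {}")
      (simp, metis (no_types, lifting) DiffD1 closedin_INT closedin_Int closedin_topspace)
qed

abbreviation upper_subcomplex :: "'a set \<Rightarrow> ('a \<Rightarrow> 'a \<Rightarrow> bool) \<Rightarrow> 'a \<Rightarrow> ('a \<Rightarrow> real) set" where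
  "upper_subcomplex A le a \<equiv> full_subcomplex A le (up_set A le a)"

lemma order_complex_support_nonempty:
  assumes w: "w \<in> topspace (order_complex A le)"
  obtains a where "a \<in> A" "w a \<noteq> 0"
proof -
  have "\<not> (\<forall>a\<in>A. w a = 0)"
    using order_complex_sum[OF w] sum.neutral[of A w] by (metis zero_neq_one)
  then show ?thesis using that by blast
qed

lemma order_complex_support_least:
  assumes A: "fin_poset A le" and w: "w \<in> topspace (order_complex A le)"
  obtains a where "a \<in> A" "w a \<noteq> 0" "w \<in> upper_subcomplex A le a"
proof -
  have "{a\<in>A. w a \<noteq> 0} \<noteq> {}" using order_complex_support_nonempty[OF w] by blast
  then obtain a where "a \<in> {a\<in>A. w a \<noteq> 0}" "\<And>a'. a' \<in> {a\<in>A. w a \<noteq> 0} \<Longrightarrow> le a a'"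
    using fin_poset_chain_least[OF A _ _ order_complex_chain[OF w]] by auto
  then show ?thesis
    using that w by (auto simp: full_subcomplex_def up_set_def)
qed

lemma full_subcomplex_flat_ends:
  "full_subcomplex (A \<times> UNIV) (prod_le le flat_le) (A \<times> range Some) =
    (\<Union>i. full_subcomplex (A \<times> UNIV) (prod_le le flat_le) (A \<times> {Some i}))"
    (is "?F (A \<times> range Some) = _")
proof
  show "?F (A \<times> range Some) \<subseteq> (\<Union>i. ?F (A \<times> {Some i}))"
  proof
    fix w assume w: "w \<in> ?F (A \<times> range Some)"
    then have wK: "w \<in> topspace (order_complex (A \<times> UNIV) (prod_le le flat_le))"
      using full_subcomplex_subset_topspace by blast
    obtain x where x: "x \<in> A \<times> UNIV" "w x \<noteq> 0" using order_complex_support_nonempty[OF wK] .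
    then have "x \<in> A \<times> range Some" using w unfolding full_subcomplex_def by blast
    then obtain i where i: "snd x = Some i" by auto
    have "y \<in> A \<times> {Some i}" if y: "y \<in> A \<times> UNIV" "w y \<noteq> 0" for y
    proof -
      have "y \<in> A \<times> range Some" using w y unfolding full_subcomplex_def by blast
      then show ?thesis
        using order_complex_comparable[OF wK x(1) y(1) x(2) y(2)] i
        by (auto simp: prod_le_def flat_le_def)
    qed
    then show "w \<in> (\<Union>i. ?F (A \<times> {Some i}))" using wK by (auto simp: full_subcomplex_def)
  qed
  show "(\<Union>i. ?F (A \<times> {Some i})) \<subseteq> ?F (A \<times> range Some)"
    by (intro UN_least full_subcomplex_mono) auto
qed

subsection \<open>Simplicial maps\<close>

lemma realize_map_nonzero_iff:
  assumes "finite A" "w \<in> topspace (order_complex A le)" "b \<in> B"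
  shows "realize_map A B g w b \<noteq> 0 \<longleftrightarrow> (\<exists>a\<in>A. g a = b \<and> w a \<noteq> 0)"
proof -
  have "(\<Sum>a\<in>{a\<in>A. g a = b}. w a) = 0 \<longleftrightarrow> (\<forall>a\<in>{a\<in>A. g a = b}. w a = 0)"
    using assms by (intro sum_nonneg_eq_0_iff) (auto simp: order_complex_nonneg)
  then show ?thesis using assms(3) by (auto simp: realize_map_def)
qed

lemma realize_map_in_order_complex:
  assumes "finite A" "finite B" and g: "order_preserving A leA B leB g"
    and w: "w \<in> topspace (order_complex A leA)"
  shows "realize_map A B g w \<in> topspace (order_complex B leB)"
proof (rule order_complexI)
  show "realize_map A B g w \<in> extensional B" by (simp add: realize_map_def)
  show "0 \<le> realize_map A B g w b" if "b \<in> B" for b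
    using that order_complex_nonneg[OF w] by (auto simp: realize_map_def intro: sum_nonneg)
  have "(\<Sum>b\<in>B. realize_map A B g w b) = (\<Sum>b\<in>B. \<Sum>a\<in>{a\<in>A. g a = b}. w a)"
    by (simp add: realize_map_def)
  also have "\<dots> = (\<Sum>a\<in>A. w a)"
    using assms(1,2) order_preserving_mem[OF g] by (intro sum.group) auto
  finally show "(\<Sum>b\<in>B. realize_map A B g w b) = 1" by (simp add: order_complex_sum[OF w])
  fix b b' assume "b \<in> B" "b' \<in> B" "realize_map A B g w b \<noteq> 0" "realize_map A B g w b' \<noteq> 0"
  then obtain a a' where "a \<in> A" "w a \<noteq> 0" "g a = b" and "a' \<in> A" "w a' \<noteq> 0" "g a' = b'"
    using realize_map_nonzero_iff[OF assms(1) w] by metis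
  then show "leB b b' \<or> leB b' b"
    using order_complex_comparable[OF w] order_preserving_le[OF g] by blast
qed

lemma realize_map_in_full_subcomplex:
  assumes "finite A" "finite B" and g: "order_preserving A leA B leB g"
    and w: "w \<in> full_subcomplex A leA U" and gU: "\<And>a. a \<in> A \<Longrightarrow> a \<in> U \<Longrightarrow> g a \<in> V"
  shows "realize_map A B g w \<in> full_subcomplex B leB V"
proof -
  have w': "w \<in> topspace (order_complex A leA)" using w by (simp add: full_subcomplex_def)
  have "b \<in> V" if "b \<in> B" "realize_map A B g w b \<noteq> 0" for b
    using that w gU realize_map_nonzero_iff[OF assms(1) w' that(1)]
    by (auto simp: full_subcomplex_def)
  then show ?thesis
    using realize_map_in_order_complex[OF assms(1-3) w'] by (simp add: full_subcomplex_def)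
qed

lemma realize_map_in_upper_subcomplex:
  assumes "finite A" "finite B" and g: "order_preserving A leA B leB g"
    and a: "a \<in> A" and w: "w \<in> upper_subcomplex A leA a"
  shows "realize_map A B g w \<in> upper_subcomplex B leB (g a)"
  by (rule realize_map_in_full_subcomplex[OF assms(1-3) w]) (rule order_preserving_up_set[OF g a])

lemma continuous_map_realize_map:
  assumes "finite A" "finite B" "order_preserving A leA B leB g"
  shows "continuous_map (order_complex A leA) (order_complex B leB) (realize_map A B g)"
  unfolding continuous_map_into_order_complex
proof (intro conjI ballI)
  show "realize_map A B g \<in> topspace (order_complex A leA) \<rightarrow> topspace (order_complex B leB)"
    using realize_map_in_order_complex[OF assms] by blast
  show "continuous_map (order_complex A leA) euclideanreal (\<lambda>w. realize_map A B g w b)" if "b \<in> B" for b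
    using that assms(1)
    by (auto simp: realize_map_def intro!: continuous_map_sum continuous_map_order_complex_coordinate)
qed

lemma realize_map_compose:
  assumes "finite A" "finite B" "\<And>a. a \<in> A \<Longrightarrow> g a \<in> B"
  shows "realize_map B C g' (realize_map A B g w) = realize_map A C (g' \<circ> g) w"
proof
  fix c
  have "(\<Sum>b\<in>{b\<in>B. g' b = c}. \<Sum>a\<in>{a\<in>A. g a = b}. w a)
      = (\<Sum>b\<in>{b\<in>B. g' b = c}. \<Sum>a\<in>{a\<in>{a\<in>A. g' (g a) = c}. g a = b}. w a)"
    by (intro sum.cong) auto
  also have "\<dots> = (\<Sum>a\<in>{a\<in>A. g' (g a) = c}. w a)"
    using assms by (intro sum.group) auto
  finally show "realize_map B C g' (realize_map A B g w) c = realize_map A C (g' \<circ> g) w c"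
    by (simp add: realize_map_def restrict_def)
qed

lemma realize_map_ident:
  assumes "w \<in> topspace (order_complex A le)" "\<And>a. a \<in> A \<Longrightarrow> g a = a"
  shows "realize_map A A g w = w"
proof
  fix b
  have "{a\<in>A. g a = b} = (if b \<in> A then {b} else {})" using assms(2) by auto
  then show "realize_map A A g w b = w b"
    using order_complex_extensional[OF assms(1)] by (auto simp: realize_map_def extensional_def)
qed

lemma realize_map_inclusion:
  assumes "a \<in> A"
  shows "realize_map U A id w a = (if a \<in> U then w a else 0)"
proof -
  have "{x\<in>U. id x = a} = (if a \<in> U then {a} else {})" by auto
  then show ?thesis using assms by (simp add: realize_map_def)
qed

lemma continuous_map_restrict_full_subcomplex:
  assumes "finite A" "U \<subseteq> A"
  shows "continuous_map (subtopology (order_complex A le) (full_subcomplex A le U))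
    (order_complex U le) (\<lambda>w. restrict w U)"
  unfolding continuous_map_into_order_complex topspace_full_subcomplex
proof (intro conjI ballI funcsetI)
  fix w assume "w \<in> full_subcomplex A le U"
  then have w: "w \<in> topspace (order_complex A le)" and supp: "\<And>a. a \<in> A \<Longrightarrow> w a \<noteq> 0 \<Longrightarrow> a \<in> U"
    by (auto simp: full_subcomplex_def)
  have "(\<Sum>a\<in>U. restrict w U a) = (\<Sum>a\<in>A. w a)"
    using assms supp by (intro sum.mono_neutral_cong_left) auto
  then show "restrict w U \<in> topspace (order_complex U le)"
    using assms(2) order_complex_sum[OF w] order_complex_nonneg[OF w]
      order_complex_comparable[OF w subsetD[OF assms(2)] subsetD[OF assms(2)]]
    by (intro order_complexI) auto
next
  show "continuous_map (subtopology (order_complex A le) (full_subcomplex A le U)) euclideanreal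
      (\<lambda>w. restrict w U a)" if "a \<in> U" for a
    using that assms(2)
    by (auto intro!: continuous_map_from_subtopology continuous_map_order_complex_coordinate)
qed

lemma order_complex_homeomorphic_full_subcomplex:
  assumes "finite A" "U \<subseteq> A"
  shows "order_complex U le homeomorphic_space
         subtopology (order_complex A le) (full_subcomplex A le U)"
proof -
  let ?K = "subtopology (order_complex A le) (full_subcomplex A le U)"
  let ?i = "realize_map U A id" and ?r = "\<lambda>w. restrict w U"
  have fin: "finite U" using assms finite_subset by blast
  have incl: "order_preserving U le A le id" using assms(2) by (auto simp: order_preserving_def)
  have "?i w \<in> full_subcomplex A le U" if "w \<in> topspace (order_complex U le)" for w
    by (rule realize_map_in_full_subcomplex[OF fin assms(1) incl, of _ U]) (use that in simp_all)
  then have "continuous_map (order_complex U le) ?K ?i"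
    using continuous_map_realize_map[OF fin assms(1) incl] by (auto simp: continuous_map_in_subtopology)
  moreover have "?r (?i w) = w" if "w \<in> topspace (order_complex U le)" for w
    using order_complex_extensional[OF that] assms(2)
    by (auto simp: fun_eq_iff realize_map_inclusion extensional_def restrict_def)
  moreover have "?i (?r w) = w" if "w \<in> topspace ?K" for w
  proof
    fix a
    show "?i (?r w) a = w a"
      using that realize_map_inclusion[of a A U "?r w"] order_complex_extensional[of w A le]
      by (cases "a \<in> A") (auto simp: full_subcomplex_def realize_map_def extensional_def)
  qed
  ultimately show ?thesis
    using continuous_map_restrict_full_subcomplex[OF assms]
    unfolding homeomorphic_space_def homeomorphic_maps_def by blast
qed

lemma homotopically_trivial_iff_full_subcomplex:
  assumes "finite A" "U \<subseteq> A"
  shows "homotopically_trivial U le \<longleftrightarrow> full_subcomplex A le U \<noteq> {} \<and>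
    contractible_space (subtopology (order_complex A le) (full_subcomplex A le U))"
proof -
  note homeo = order_complex_homeomorphic_full_subcomplex[OF assms, of le]
  have "topspace (order_complex U le) = {} \<longleftrightarrow> full_subcomplex A le U = {}"
    using homeomorphic_empty_space[OF homeo] topspace_full_subcomplex[of A le U]
    unfolding null_topspace_iff_trivial[symmetric] by simp
  then show ?thesis
    unfolding homotopically_trivial_def homeomorphic_space_contractibility[OF homeo] by simp
qed

subsection \<open>Homotopies between comparable maps\<close>

text \<open>Lay out the chain supporting \<open>w\<close> in increasing order as consecutive intervals of lengths \<open>w a\<close>,
  filling \<open>[0, 1]\<close>, and cut at \<open>t\<close>: this is the length of the part of the interval of \<open>a\<close> left of \<open>t\<close>.\<close>

definition mass_below :: "'a set \<Rightarrow> ('a \<Rightarrow> 'a \<Rightarrow> bool) \<Rightarrow> real \<Rightarrow> ('a \<Rightarrow> real) \<Rightarrow> 'a \<Rightarrow> real" where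
  "mass_below A le t w a = max 0 (min (w a) (t - (\<Sum>x\<in>{x\<in>A. le x a \<and> x \<noteq> a}. w x)))"

definition prism_map ::
  "'a set \<Rightarrow> ('a \<Rightarrow> 'a \<Rightarrow> bool) \<Rightarrow> real \<Rightarrow> ('a \<Rightarrow> real) \<Rightarrow> ('a \<times> bool \<Rightarrow> real)" where
  "prism_map A le t w =
     (\<lambda>(a, i)\<in>A \<times> UNIV. if i then w a - mass_below A le t w a else mass_below A le t w a)"

lemma mass_below_bounds:
  assumes "w \<in> topspace (order_complex A le)" "a \<in> A"
  shows "0 \<le> mass_below A le t w a" "mass_below A le t w a \<le> w a"
  using order_complex_nonneg[OF assms] by (auto simp: mass_below_def)

lemma mass_below_0:
  assumes "w \<in> topspace (order_complex A le)"
  shows "mass_below A le 0 w a = 0"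
proof -
  have "0 \<le> (\<Sum>x\<in>{x\<in>A. le x a \<and> x \<noteq> a}. w x)"
    using order_complex_nonneg[OF assms] by (auto intro: sum_nonneg)
  then show ?thesis by (simp add: mass_below_def)
qed

lemma mass_below_1:
  assumes "finite A" and w: "w \<in> topspace (order_complex A le)" and a: "a \<in> A"
  shows "mass_below A le 1 w a = w a"
proof -
  let ?S = "{x\<in>A. le x a \<and> x \<noteq> a}"
  have "w a + (\<Sum>x\<in>?S. w x) = (\<Sum>x\<in>insert a ?S. w x)"
    using assms(1) by simp
  also have "\<dots> \<le> (\<Sum>x\<in>A. w x)"
    using assms(1) a order_complex_nonneg[OF w] by (intro sum_mono2) auto
  finally have "w a + (\<Sum>x\<in>?S. w x) \<le> 1" by (simp add: order_complex_sum[OF w])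
  then show ?thesis
    using order_complex_nonneg[OF w a] by (simp add: mass_below_def)
qed

lemma mass_below_cut:
  assumes A: "fin_poset A le" and w: "w \<in> topspace (order_complex A le)"
    and a: "a \<in> A" "mass_below A le t w a \<noteq> 0" and b: "b \<in> A" "mass_below A le t w b \<noteq> w b"
  shows "le a b"
proof (rule ccontr)
  assume not_le: "\<not> le a b"
  let ?pred = "\<lambda>a. {x\<in>A. le x a \<and> x \<noteq> a}"
  have ne: "a \<noteq> b" using not_le fin_poset_refl[OF A a(1)] by blast
  have "w a \<noteq> 0" "w b \<noteq> 0"
    using a(2) b(2) mass_below_bounds[OF w a(1), of t] mass_below_bounds[OF w b(1), of t] by auto
  then have ba: "le b a" using order_complex_comparable[OF w a(1) b(1)] not_le by blast
  have "w b + (\<Sum>x\<in>?pred b. w x) = (\<Sum>x\<in>insert b (?pred b). w x)"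
    using fin_poset_finite[OF A] by simp
  also have "\<dots> \<le> (\<Sum>x\<in>?pred a. w x)"
  proof (rule sum_mono2)
    show "insert b (?pred b) \<subseteq> ?pred a"
      using ba ne b(1) not_le fin_poset_trans[OF A _ b(1) a(1) _ ba] by auto
  qed (use fin_poset_finite[OF A] order_complex_nonneg[OF w] in auto)
  also have "\<dots> < t"
    using a(2) order_complex_nonneg[OF w a(1)] by (auto simp: mass_below_def)
  finally have "mass_below A le t w b = w b"
    using order_complex_nonneg[OF w b(1)] by (simp add: mass_below_def)
  with b(2) show False ..
qed

lemma prism_map_in_order_complex:
  assumes A: "fin_poset A le" and w: "w \<in> topspace (order_complex A le)"
  shows "prism_map A le t w \<in> topspace (order_complex (A \<times> UNIV) (prod_le le (\<le>)))"
proof (rule order_complexI)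
  let ?v = "prism_map A le t w"
  show "?v \<in> extensional (A \<times> UNIV)" by (simp add: prism_map_def)
  show "0 \<le> ?v x" if "x \<in> A \<times> UNIV" for x
    using that mass_below_bounds[OF w] by (auto simp: prism_map_def)
  have "(\<Sum>x\<in>A \<times> UNIV. ?v x) = (\<Sum>a\<in>A. \<Sum>i\<in>UNIV. ?v (a, i))"
    by (simp add: sum.cartesian_product case_prod_eta)
  also have "\<dots> = (\<Sum>a\<in>A. w a)"
    by (intro sum.cong) (simp_all add: prism_map_def UNIV_bool)
  finally show "(\<Sum>x\<in>A \<times> UNIV. ?v x) = 1" by (simp add: order_complex_sum[OF w])
  have supp: "a \<in> A" "w a \<noteq> 0" "if i then mass_below A le t w a \<noteq> w a else mass_below A le t w a \<noteq> 0"
    if "(a, i) \<in> A \<times> UNIV" "?v (a, i) \<noteq> 0" for a i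
    using that mass_below_bounds[OF w, of a t] by (auto simp: prism_map_def split: if_splits)
  fix x y assume x: "x \<in> A \<times> UNIV" "?v x \<noteq> 0" and y: "y \<in> A \<times> UNIV" "?v y \<noteq> 0"
  obtain a i b j where xy: "x = (a, i)" "y = (b, j)" by (metis surj_pair)
  note supp_xy = supp[OF x[unfolded xy(1)]] supp[OF y[unfolded xy(2)]]
  show "prod_le le (\<le>) x y \<or> prod_le le (\<le>) y x"
  proof (cases "i = j")
    case True
    then show ?thesis
      using order_complex_comparable[OF w supp_xy(1,4,2,5)] by (simp add: xy prod_le_def)
  next
    case False
    then show ?thesis
      using supp_xy mass_below_cut[OF A w, of a t b] mass_below_cut[OF A w, of b t a]
      by (cases i) (auto simp: xy prod_le_def)
  qed
qed

lemma continuous_map_prism_map: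
  assumes A: "fin_poset A le"
  shows "continuous_map (prod_topology (top_of_set {0..1::real}) (order_complex A le))
    (order_complex (A \<times> UNIV) (prod_le le (\<le>))) (\<lambda>(t, w). prism_map A le t w)"
  unfolding continuous_map_into_order_complex
proof (intro conjI ballI)
  let ?I = "prod_topology (top_of_set {0..1::real}) (order_complex A le)"
  show "(\<lambda>(t, w). prism_map A le t w) \<in> topspace ?I \<rightarrow>
      topspace (order_complex (A \<times> UNIV) (prod_le le (\<le>)))"
    using prism_map_in_order_complex[OF A] by auto
  have fst_cont: "continuous_map ?I euclideanreal fst"
    using continuous_map_fst continuous_map_into_fulltopology by blast
  have coord_cont: "continuous_map ?I euclideanreal (\<lambda>z. snd z a)" if "a \<in> A" for a
    using continuous_map_compose[OF continuous_map_snd continuous_map_order_complex_coordinate[OF that]]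
    by (simp add: o_def)
  have mass_cont: "continuous_map ?I euclideanreal (\<lambda>z. mass_below A le (fst z) (snd z) a)"
    if "a \<in> A" for a
    unfolding mass_below_def using that fin_poset_finite[OF A]
    by (intro continuous_intros fst_cont coord_cont continuous_map_sum) auto
  fix x :: "'a \<times> bool" assume "x \<in> A \<times> UNIV"
  then obtain a i where "x = (a, i)" "a \<in> A" by blast
  then show "continuous_map ?I euclideanreal (\<lambda>z. (case z of (t, w) \<Rightarrow> prism_map A le t w) x)"
    by (cases i) (auto simp: prism_map_def case_prod_beta intro!: continuous_intros coord_cont mass_cont)
qed

lemma realize_map_cylinder_end:
  "realize_map A (A \<times> UNIV) (\<lambda>a. (a, j)) w = (\<lambda>(a, i)\<in>A \<times> UNIV. if i = j then w a else 0)"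
proof
  fix x
  have "{a\<in>A. (a, j) = x} = (if fst x \<in> A \<and> snd x = j then {fst x} else {})"
    by (cases x) auto
  then show "realize_map A (A \<times> UNIV) (\<lambda>a. (a, j)) w x =
      (\<lambda>(a, i)\<in>A \<times> UNIV. if i = j then w a else 0) x"
    by (cases x) (auto simp: realize_map_def)
qed

lemma realize_map_cylinder_ends_homotopic:
  assumes A: "fin_poset A le"
  shows "homotopic_with (\<lambda>x. True) (order_complex A le) (order_complex (A \<times> UNIV) (prod_le le (\<le>)))
    (realize_map A (A \<times> UNIV) (\<lambda>a. (a, True))) (realize_map A (A \<times> UNIV) (\<lambda>a. (a, False)))"
proof -
  have "homotopic_with (\<lambda>x. True) (order_complex A le) (order_complex (A \<times> UNIV) (prod_le le (\<le>)))
      (prism_map A le 0) (prism_map A le 1)"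
    unfolding homotopic_with_def using continuous_map_prism_map[OF A] by (intro exI conjI) auto
  then show ?thesis
  proof (rule homotopic_with_eq)
    fix w assume w: "w \<in> topspace (order_complex A le)"
    show "realize_map A (A \<times> UNIV) (\<lambda>a. (a, True)) w = prism_map A le 0 w"
      unfolding realize_map_cylinder_end prism_map_def
      by (intro restrict_ext) (auto simp: mass_below_0[OF w])
    show "realize_map A (A \<times> UNIV) (\<lambda>a. (a, False)) w = prism_map A le 1 w"
      unfolding realize_map_cylinder_end prism_map_def
      by (intro restrict_ext) (auto simp: mass_below_1[OF fin_poset_finite[OF A] w])
  qed auto
qed

lemma realize_map_homotopic:
  assumes A: "fin_poset A leA" and B: "fin_poset B leB"
    and f: "order_preserving A leA B leB f" and g: "order_preserving A leA B leB g"
    and le: "\<And>a. a \<in> A \<Longrightarrow> leB (f a) (g a)"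
  shows "homotopic_with (\<lambda>x. True) (order_complex A leA) (order_complex B leB)
           (realize_map A B f) (realize_map A B g)"
proof -
  let ?c = "\<lambda>(a, i). if i then g a else f a"
  have fin: "finite A" "finite (A \<times> (UNIV :: bool set))" "finite B"
    using A B by (auto simp: fin_poset_finite)
  have f_le_g: "leB (f a) (g b)" if "a \<in> A" "b \<in> A" "leA a b" for a b
    using fin_poset_trans[OF B _ _ _ order_preserving_le[OF f that] le[OF that(2)]]
      order_preserving_mem[OF f] order_preserving_mem[OF g] that by blast
  have "order_preserving (A \<times> UNIV) (prod_le leA (\<le>)) B leB ?c"
    unfolding order_preserving_def[of "A \<times> UNIV"]
    using order_preserving_mem[OF f] order_preserving_mem[OF g]
      order_preserving_le[OF f] order_preserving_le[OF g] f_le_g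
    by (auto simp: prod_le_def split: if_splits)
  from continuous_map_realize_map[OF fin(2,3) this]
  have "homotopic_with (\<lambda>x. True) (order_complex A leA) (order_complex B leB)
      (realize_map (A \<times> UNIV) B ?c \<circ> realize_map A (A \<times> UNIV) (\<lambda>a. (a, True)))
      (realize_map (A \<times> UNIV) B ?c \<circ> realize_map A (A \<times> UNIV) (\<lambda>a. (a, False)))"
    by (rule homotopic_with_compose_continuous_map_left[OF
          realize_map_cylinder_ends_homotopic[OF A]]) simp
  from homotopic_with_symD[OF this] show ?thesis
    by (rule homotopic_with_eq) (auto simp: realize_map_compose[OF fin(1,2)] o_def)
qed

lemma homotopically_trivial_least:
  assumes A: "fin_poset A le" and b: "b \<in> A" and least: "\<And>a. a \<in> A \<Longrightarrow> le b a"
  shows "homotopically_trivial A le"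
proof -
  let ?K = "order_complex A le" and ?vertex = "\<lambda>a\<in>A. if a = b then 1 else 0 :: real"
  have const: "order_preserving A le A le (\<lambda>a. b)"
    using b fin_poset_refl[OF A b] by (simp add: order_preserving_def)
  have ident: "order_preserving A le A le id"
    by (simp add: order_preserving_def)
  have "homotopic_with (\<lambda>x. True) ?K ?K (realize_map A A (\<lambda>a. b)) (realize_map A A id)"
    using least by (intro realize_map_homotopic A const ident) simp
  then have "homotopic_with (\<lambda>x. True) ?K ?K (\<lambda>w. ?vertex) id"
  proof (rule homotopic_with_eq)
    fix w assume w: "w \<in> topspace ?K"
    show "id w = realize_map A A id w" using realize_map_ident[OF w, of id] by simp
    show "?vertex = realize_map A A (\<lambda>a. b) w"
      unfolding realize_map_def by (intro restrict_ext) (auto simp: order_complex_sum[OF w])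
  qed auto
  then have "contractible_space ?K"
    unfolding contractible_space_def using homotopic_with_symD by blast
  moreover have "?vertex \<in> topspace ?K"
    using b fin_poset_refl[OF A b] fin_poset_finite[OF A]
    by (intro order_complexI) (auto split: if_splits)
  ultimately show ?thesis unfolding homotopically_trivial_def by blast
qed

lemma homotopy_equivalent_order_complex_galois:
  assumes D: "fin_poset D leD" and E: "fin_poset E leE"
    and l: "order_preserving E leE D leD l" and r: "order_preserving D leD E leE r"
    and unit: "\<And>e. e \<in> E \<Longrightarrow> leE e (r (l e))" and counit: "\<And>d. d \<in> D \<Longrightarrow> leD (l (r d)) d"
  shows "order_complex D leD homotopy_equivalent_space order_complex E leE"
proof -
  have fin: "finite D" "finite E" using D E by (simp_all add: fin_poset_finite)
  let ?l = "realize_map E D l" and ?r = "realize_map D E r"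
  have "homotopic_with (\<lambda>x. True) (order_complex D leD) (order_complex D leD)
      (realize_map D D (l \<circ> r)) (realize_map D D id)"
    using l r counit by (intro realize_map_homotopic D) (auto simp: order_preserving_def)
  then have lr: "homotopic_with (\<lambda>x. True) (order_complex D leD) (order_complex D leD) (?l \<circ> ?r) id"
    by (rule homotopic_with_eq)
      (auto simp: realize_map_compose[OF fin] order_preserving_mem[OF r] realize_map_ident)
  have "homotopic_with (\<lambda>x. True) (order_complex E leE) (order_complex E leE)
      (realize_map E E id) (realize_map E E (r \<circ> l))"
    using l r unit by (intro realize_map_homotopic E) (auto simp: order_preserving_def)
  then have "homotopic_with (\<lambda>x. True) (order_complex E leE) (order_complex E leE) id (?r \<circ> ?l)"
    by (rule homotopic_with_eq)
      (auto simp: realize_map_compose[OF fin(2,1)] order_preserving_mem[OF l] realize_map_ident)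
  from homotopic_with_symD[OF this] show ?thesis
    using lr continuous_map_realize_map[OF fin r] continuous_map_realize_map[OF fin(2,1) l]
    unfolding homotopy_equivalent_space_def by blast
qed

lemma homotopically_trivial_galois:
  assumes "fin_poset D leD" "fin_poset E leE"
    and l: "order_preserving E leE D leD l" and "order_preserving D leD E leE r"
    and "\<And>e. e \<in> E \<Longrightarrow> leE e (r (l e))" "\<And>d. d \<in> D \<Longrightarrow> leD (l (r d)) d"
    and triv: "homotopically_trivial E leE"
  shows "homotopically_trivial D leD"
proof -
  have "contractible_space (order_complex D leD)"
    using homotopy_equivalent_space_contractibility[OF
        homotopy_equivalent_order_complex_galois[OF assms(1-6)]] triv by (simp add: homotopically_trivial_def)
  moreover have "topspace (order_complex D leD) \<noteq> {}"
    using triv realize_map_in_order_complex[OF assms(2,1)[THEN fin_poset_finite] l]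
    unfolding homotopically_trivial_def by blast
  ultimately show ?thesis by (simp add: homotopically_trivial_def)
qed

subsection \<open>Contractible carriers\<close>

definition contractible_carrier ::
  "'b set \<Rightarrow> ('b \<Rightarrow> 'b \<Rightarrow> bool) \<Rightarrow> 'y topology \<Rightarrow> ('b \<Rightarrow> 'y set) \<Rightarrow> bool" where
  "contractible_carrier B le Y C \<longleftrightarrow>
     (\<forall>b\<in>B. C b \<subseteq> topspace Y \<and> C b \<noteq> {} \<and> contractible_space (subtopology Y (C b))) \<and>
     (\<forall>a\<in>B. \<forall>b\<in>B. le a b \<longrightarrow> C b \<subseteq> C a)"

definition carried_on ::
  "'b set \<Rightarrow> ('b \<Rightarrow> 'b \<Rightarrow> bool) \<Rightarrow> 'b set \<Rightarrow> ('b \<Rightarrow> 'y set) \<Rightarrow> (('b \<Rightarrow> real) \<Rightarrow> 'y) \<Rightarrow> bool" where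
  "carried_on B le U C f \<longleftrightarrow> (\<forall>b\<in>U. f ` upper_subcomplex B le b \<subseteq> C b)"

lemma carried_onD: "carried_on B le U C f \<Longrightarrow> b \<in> U \<Longrightarrow> w \<in> upper_subcomplex B le b \<Longrightarrow> f w \<in> C b"
  by (auto simp: carried_on_def)

lemma carried_onI:
  "(\<And>b w. b \<in> U \<Longrightarrow> w \<in> upper_subcomplex B le b \<Longrightarrow> f w \<in> C b) \<Longrightarrow> carried_on B le U C f"
  by (auto simp: carried_on_def)

lemma contractible_carrier_order_preserving:
  assumes "contractible_carrier B leB Y C" and g: "order_preserving A leA B leB g"
  shows "contractible_carrier A leA Y (\<lambda>a. C (g a))"
  using assms(1) order_preserving_mem[OF g] order_preserving_le[OF g]
  unfolding contractible_carrier_def by simp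

lemma contractible_carrier_full_subcomplex:
  assumes A: "finite A" and U: "\<And>b. b \<in> B \<Longrightarrow> U b \<subseteq> A"
    and anti: "\<And>a b. a \<in> B \<Longrightarrow> b \<in> B \<Longrightarrow> leB a b \<Longrightarrow> U b \<subseteq> U a"
    and triv: "\<And>b. b \<in> B \<Longrightarrow> homotopically_trivial (U b) leA"
  shows "contractible_carrier B leB (order_complex A leA) (\<lambda>b. full_subcomplex A leA (U b))"
  unfolding contractible_carrier_def
proof (intro conjI ballI impI)
  fix b assume b: "b \<in> B"
  show "full_subcomplex A leA (U b) \<subseteq> topspace (order_complex A leA)"
    by (rule full_subcomplex_subset_topspace)
  show "full_subcomplex A leA (U b) \<noteq> {}"
    "contractible_space (subtopology (order_complex A leA) (full_subcomplex A leA (U b)))"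
    using triv[OF b] homotopically_trivial_iff_full_subcomplex[OF A U[OF b], of leA] by simp_all
qed (intro full_subcomplex_mono anti)

lemma contractible_carrier_upper_subcomplex:
  assumes B: "fin_poset B le"
  shows "contractible_carrier B le (order_complex B le) (upper_subcomplex B le)"
proof (rule contractible_carrier_full_subcomplex)
  show "up_set B le b \<subseteq> B" for b by (auto simp: up_set_def)
  then show "homotopically_trivial (up_set B le b) le" if "b \<in> B" for b
    using up_set_self[OF B that]
    by (intro homotopically_trivial_least[of _ _ b] fin_poset_subset[OF B]) (auto simp: up_set_def)
qed (use up_set_antimono[OF B] fin_poset_finite[OF B] in auto)

definition radial_projection :: "'b set \<Rightarrow> 'b \<Rightarrow> ('b \<Rightarrow> real) \<Rightarrow> 'b \<Rightarrow> real" where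
  "radial_projection B b w = (\<lambda>a\<in>B. if a = b then 0 else w a / (1 - w b))"

lemma radial_projection_in_full_subcomplex:
  assumes B: "finite B" "b \<in> B" and w: "w \<in> full_subcomplex B le U" "w b < 1"
  shows "radial_projection B b w \<in> full_subcomplex B le (U - {b})"
proof -
  let ?r = "radial_projection B b w"
  have wK: "w \<in> topspace (order_complex B le)" using w(1) by (simp add: full_subcomplex_def)
  have "(\<Sum>a\<in>B. ?r a) = (\<Sum>a\<in>B - {b}. w a / (1 - w b))"
    using B by (simp add: sum.remove radial_projection_def)
  also have "\<dots> = (\<Sum>a\<in>B - {b}. w a) / (1 - w b)"
    by (simp add: sum_divide_distrib)
  also have "(\<Sum>a\<in>B - {b}. w a) = 1 - w b"
    using B order_complex_sum[OF wK] by (simp add: sum_diff1)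
  finally have "(\<Sum>a\<in>B. ?r a) = 1" using w(2) by simp
  then have "?r \<in> topspace (order_complex B le)"
    using w(2) order_complex_nonneg[OF wK] order_complex_comparable[OF wK]
    by (intro order_complexI) (auto simp: radial_projection_def split: if_splits)
  then show ?thesis
    using w(1) by (auto simp: full_subcomplex_def radial_projection_def split: if_splits)
qed

lemma radial_projection_ident:
  assumes "b \<in> B" "w \<in> full_subcomplex B le (U - {b})"
  shows "radial_projection B b w = w"
proof
  fix a
  have "w \<in> extensional B" "w b = 0"
    using assms by (auto simp: full_subcomplex_def topspace_order_complex)
  then show "radial_projection B b w a = w a"
    using extensional_arb[of w B a] by (simp add: radial_projection_def restrict_def)
qed

lemma full_subcomplex_retract_of_punctured:
  assumes B: "finite B" "b \<in> B"
  shows "full_subcomplex B le (U - {b}) retract_of_space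
    subtopology (order_complex B le) {w \<in> full_subcomplex B le U. w b < 1}"
proof -
  let ?K = "order_complex B le" and ?N = "{w \<in> full_subcomplex B le U. w b < 1}"
  let ?X = "subtopology ?K ?N" and ?L = "full_subcomplex B le (U - {b})" and ?r = "radial_projection B b"
  have topX: "topspace ?X = ?N" using full_subcomplex_subset_topspace[of B le U] by auto
  have r_in: "?r w \<in> ?L" if "w \<in> ?N" for w
    using radial_projection_in_full_subcomplex[OF B] that by blast
  have "continuous_map ?X ?K ?r"
    unfolding continuous_map_into_order_complex
  proof (intro conjI ballI)
    show "?r \<in> topspace ?X \<rightarrow> topspace ?K"
      unfolding topX using r_in full_subcomplex_subset_topspace[of B le "U - {b}"] by blast
    have coord: "continuous_map ?X euclideanreal (\<lambda>w. w a)" if "a \<in> B" for a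
      using that by (intro continuous_map_from_subtopology continuous_map_order_complex_coordinate)
    show "continuous_map ?X euclideanreal (\<lambda>w. ?r w a)" if "a \<in> B" for a
      using that topX B unfolding radial_projection_def
      by (cases "a = b") (auto intro!: continuous_map_real_divide continuous_intros coord)
  qed
  then have r_cont: "continuous_map ?X (subtopology ?K ?L) ?r"
    by (rule continuous_map_into_subtopology) (unfold topX, use r_in in blast)
  have "?L \<subseteq> ?N"
    using B(2) by (auto simp: full_subcomplex_def)
  then show ?thesis
    using r_cont radial_projection_ident[OF B(2)] unfolding retract_of_space_def topX
    by (auto simp: subtopology_subtopology inf_absorb2)
qed

lemma full_subcomplex_extension_over_vertex:
  assumes B: "finite B" "b \<in> B"
    and h: "continuous_map (subtopology (order_complex B le) (full_subcomplex B le (U - {b}))) Y h"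
    and Y: "contractible_space Y" "topspace Y \<noteq> {}"
  obtains H where "continuous_map (subtopology (order_complex B le) (full_subcomplex B le U)) Y H"
    "\<And>w. w \<in> full_subcomplex B le (U - {b}) \<Longrightarrow> H w = h w"
proof -
  let ?K = "order_complex B le" and ?L = "full_subcomplex B le (U - {b})"
  let ?X = "subtopology ?K (full_subcomplex B le U)" and ?N = "{w \<in> full_subcomplex B le U. w b < 1}"
  have LU: "?L \<subseteq> full_subcomplex B le U" by (intro full_subcomplex_mono) auto
  have X_sub: "subtopology ?X S = subtopology ?K S" if "S \<subseteq> full_subcomplex B le U" for S
    using that by (simp add: subtopology_subtopology inf_absorb2)
  have "normal_space ?X"
    by (intro metrizable_imp_normal_space metrizable_space_subtopology metrizable_space_order_complex B)
  moreover have "closedin ?X ?L"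
    using LU by (simp add: closedin_subset_topspace closedin_full_subcomplex)
  moreover have "openin ?X ?N"
  proof -
    have "continuous_map ?X euclideanreal (\<lambda>w. w b)"
      by (intro continuous_map_from_subtopology continuous_map_order_complex_coordinate B)
    from openin_continuous_map_preimage[OF this, of "{..<1}"] show ?thesis
      unfolding topspace_full_subcomplex by simp
  qed
  moreover have "?L retract_of_space subtopology ?X ?N"
    using full_subcomplex_retract_of_punctured[OF B, of le U] X_sub[of ?N] by simp
  moreover have "continuous_map (subtopology ?X ?L) Y h"
    using h X_sub[OF LU] by simp
  ultimately show ?thesis
    using contractible_space_extension[OF _ _ _ _ Y] that by blast
qed

lemma full_subcomplex_insert_minimal:
  assumes B: "fin_poset B le" and V: "up_closed B le V" and b: "b \<in> B - V"
    and up: "up_set B le b \<subseteq> insert b V"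
  shows "full_subcomplex B le (insert b V) = full_subcomplex B le V \<union> upper_subcomplex B le b"
    and "full_subcomplex B le V \<inter> upper_subcomplex B le b =
      full_subcomplex B le (up_set B le b - {b})"
proof -
  have "w \<in> upper_subcomplex B le b"
    if w: "w \<in> full_subcomplex B le (insert b V)" and wb: "w b \<noteq> 0" for w
  proof -
    have "a \<in> up_set B le b" if "a \<in> B" "w a \<noteq> 0" for a
    proof -
      have wK: "w \<in> topspace (order_complex B le)" and a: "a \<in> insert b V"
        using w that by (auto simp: full_subcomplex_def)
      have "\<not> le a b" if "a \<in> V"
        using that V b by (auto simp: up_closed_def up_set_def)
      then show ?thesis
        using order_complex_comparable[OF wK \<open>a \<in> B\<close> _ \<open>w a \<noteq> 0\<close> wb] a b that up_set_self[OF B]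
        by (auto simp: up_set_def)
    qed
    then show ?thesis using w by (auto simp: full_subcomplex_def)
  qed
  moreover have "w \<in> full_subcomplex B le V" if "w \<in> full_subcomplex B le (insert b V)" "w b = 0" for w
    using that by (auto simp: full_subcomplex_def)
  ultimately show "full_subcomplex B le (insert b V) = full_subcomplex B le V \<union> upper_subcomplex B le b"
    using full_subcomplex_mono[OF up, of B le] full_subcomplex_mono[of V "insert b V" B le] by blast
  have "V \<inter> up_set B le b = up_set B le b - {b}" using b up by blast
  then show "full_subcomplex B le V \<inter> upper_subcomplex B le b =
      full_subcomplex B le (up_set B le b - {b})"
    by (simp add: full_subcomplex_Int)
qed

lemma carried_on_link:
  assumes B: "fin_poset B le" and C: "contractible_carrier B le Y C" and b: "b \<in> B"
    and V: "up_set B le b - {b} \<subseteq> V" and h: "carried_on B le V C h"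
    and w: "w \<in> full_subcomplex B le (up_set B le b - {b})"
  shows "h w \<in> C b"
proof -
  obtain a where a: "a \<in> B" "w a \<noteq> 0" "w \<in> upper_subcomplex B le a"
    using order_complex_support_least[OF B, of w] w by (auto simp: full_subcomplex_def)
  then have "a \<in> up_set B le b - {b}" using w by (auto simp: full_subcomplex_def)
  then have "le b a" "h w \<in> C a"
    using V carried_onD[OF h _ a(3)] by (auto simp: up_set_def)
  then show ?thesis using C a(1) b unfolding contractible_carrier_def by blast
qed

lemma carried_extension_to_upper_subcomplex:
  assumes B: "fin_poset B le" and C: "contractible_carrier B le Y C" and b: "b \<in> B"
    and V: "up_set B le b - {b} \<subseteq> V" and hC: "carried_on B le V C h"
    and h: "continuous_map (subtopology (order_complex B le) (full_subcomplex B le V)) Y h"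
  obtains k where
    "continuous_map (subtopology (order_complex B le) (upper_subcomplex B le b)) (subtopology Y (C b)) k"
    "\<And>w. w \<in> full_subcomplex B le (up_set B le b - {b}) \<Longrightarrow> k w = h w"
proof -
  let ?link = "full_subcomplex B le (up_set B le b - {b})"
  have "contractible_space (subtopology Y (C b))" "topspace (subtopology Y (C b)) \<noteq> {}"
    using C b by (auto simp: contractible_carrier_def inf_absorb2)
  moreover have "continuous_map (subtopology (order_complex B le) ?link) (subtopology Y (C b)) h"
    using continuous_map_from_subtopology_mono[OF h full_subcomplex_mono[OF V]]
      carried_on_link[OF B C b V hC] by (auto simp: continuous_map_in_subtopology)
  ultimately show ?thesis
    using full_subcomplex_extension_over_vertex[OF fin_poset_finite[OF B] b] that by blast
qed

lemma carried_extension_insert: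
  assumes B: "fin_poset B le" and C: "contractible_carrier B le Y C"
    and V: "up_closed B le V" and b: "b \<in> B - V" and up: "up_set B le b \<subseteq> insert b V"
    and h: "continuous_map (subtopology (order_complex B le) (full_subcomplex B le V)) Y h"
    and hC: "carried_on B le V C h"
  obtains H where
    "continuous_map (subtopology (order_complex B le) (full_subcomplex B le (insert b V))) Y H"
    "\<And>w. w \<in> full_subcomplex B le V \<Longrightarrow> H w = h w" "carried_on B le (insert b V) C H"
proof -
  let ?K = "order_complex B le" and ?F = "full_subcomplex B le"
  let ?up = "up_set B le b" and ?X = "subtopology (order_complex B le) (full_subcomplex B le (insert b V))"
  have bB: "b \<in> B" and link_V: "?up - {b} \<subseteq> V" using b up by auto
  note cover = full_subcomplex_insert_minimal[OF B V b up]
  obtain k where k: "continuous_map (subtopology ?K (?F ?up)) (subtopology Y (C b)) k"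
    and k_eq: "\<And>w. w \<in> ?F (?up - {b}) \<Longrightarrow> k w = h w"
    using carried_extension_to_upper_subcomplex[OF B C bB link_V hC h] by blast
  have kC: "k w \<in> C b" if "w \<in> ?F ?up" for w
    using continuous_map_funspace[OF k] that unfolding topspace_full_subcomplex by auto
  have agree: "h w = k w" if "w \<in> ?F V" "w \<in> ?F ?up" for w
    using k_eq[of w] that by (simp flip: cover(2))
  define H where "H = (\<lambda>w. if w \<in> ?F V then h w else k w)"
  have H: "continuous_map ?X Y H"
    unfolding H_def
  proof (rule continuous_map_closed_pasting[where T = "?F ?up"])
    show "closedin ?X (?F V)" "closedin ?X (?F ?up)"
      unfolding cover(1) by (simp_all add: closedin_subset_topspace closedin_full_subcomplex)
    show "continuous_map (subtopology ?X (?F V)) Y h" "continuous_map (subtopology ?X (?F ?up)) Y k"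
      using h continuous_map_into_fulltopology[OF k]
      by (simp_all add: subtopology_subtopology cover(1) inf_absorb2)
  qed (use agree cover in auto)
  have HC: "H w \<in> C a" if a: "a \<in> insert b V" and w: "w \<in> upper_subcomplex B le a" for a w
  proof (cases "a = b")
    case True
    then show ?thesis using w agree[of w] kC[of w] by (auto simp: H_def)
  next
    case False
    then have "up_set B le a \<subseteq> V" using a V by (auto simp: up_closed_def)
    then have "w \<in> ?F V" using w full_subcomplex_mono by blast
    then show ?thesis using carried_onD[OF hC _ w] a False by (simp add: H_def)
  qed
  show ?thesis
  proof (rule that[OF H])
    show "H w = h w" if "w \<in> ?F V" for w using that by (simp add: H_def)
  qed (intro carried_onI HC)
qed

theorem carried_extension:
  assumes B: "fin_poset B le" and C: "contractible_carrier B le Y C" and V: "up_closed B le V"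
    and h: "continuous_map (subtopology (order_complex B le) (full_subcomplex B le V)) Y h"
    and hC: "carried_on B le V C h"
  obtains H where "continuous_map (order_complex B le) Y H"
    "\<And>w. w \<in> full_subcomplex B le V \<Longrightarrow> H w = h w" "carried_on B le B C H"
proof -
  let ?K = "order_complex B le"
  define extends_over where "extends_over U \<longleftrightarrow>
      (\<exists>H. continuous_map (subtopology ?K (full_subcomplex B le U)) Y H \<and>
        (\<forall>w\<in>full_subcomplex B le V. H w = h w) \<and> carried_on B le U C H)" for U
  have "extends_over B"
    using B V
  proof (induction rule: up_closed_induct)
    case base
    then show ?case using h hC unfolding extends_over_def by blast
  next
    case (insert U b)
    then obtain H where H: "continuous_map (subtopology ?K (full_subcomplex B le U)) Y H"
      and H_eq: "\<forall>w\<in>full_subcomplex B le V. H w = h w" and HC: "carried_on B le U C H"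
      unfolding extends_over_def by blast
    obtain H' where "continuous_map (subtopology ?K (full_subcomplex B le (insert b U))) Y H'"
      "\<And>w. w \<in> full_subcomplex B le U \<Longrightarrow> H' w = H w" "carried_on B le (insert b U) C H'"
      using carried_extension_insert[OF B C insert.hyps(1,3,4) H HC] by blast
    then show ?case
      using H_eq full_subcomplex_mono[OF insert.hyps(2), of B le]
      unfolding extends_over_def by (metis subsetD)
  qed
  then show ?thesis using that unfolding extends_over_def by auto
qed

lemma realize_map_flat_inclusions_homotopic:
  assumes B: "fin_poset B le"
  shows "homotopic_with (\<lambda>x. True) (order_complex B le)
    (order_complex (B \<times> (UNIV :: 'i::finite option set)) (prod_le le flat_le))
    (realize_map B (B \<times> UNIV) (\<lambda>b. (b, i))) (realize_map B (B \<times> UNIV) (\<lambda>b. (b, j)))"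
proof -
  have "homotopic_with (\<lambda>x. True) (order_complex B le)
      (order_complex (B \<times> (UNIV :: 'i option set)) (prod_le le flat_le))
      (realize_map B (B \<times> UNIV) (\<lambda>b. (b, None))) (realize_map B (B \<times> UNIV) (\<lambda>b. (b, k)))" for k
    by (intro realize_map_homotopic[OF B fin_poset_prod[OF B fin_poset_flat]])
      (auto simp: order_preserving_def prod_le_def flat_le_def fin_poset_refl[OF B])
  then show ?thesis using homotopic_with_trans homotopic_with_symD by blast
qed

lemma carried_maps_on_flat_ends:
  fixes B :: "'b set" and le :: "'b \<Rightarrow> 'b \<Rightarrow> bool"
  defines "M \<equiv> B \<times> (UNIV :: bool option set)" and "leM \<equiv> prod_le le flat_le"
    and "ends \<equiv> B \<times> range Some"
  assumes B: "finite B"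
    and f: "continuous_map (order_complex B le) Y f" and fC: "carried_on B le B C f"
    and g: "continuous_map (order_complex B le) Y g" and gC: "carried_on B le B C g"
  obtains h where "continuous_map (subtopology (order_complex M leM) (full_subcomplex M leM ends)) Y h"
    "carried_on M leM ends (\<lambda>x. C (fst x)) h"
    "\<And>w. w \<in> full_subcomplex M leM (B \<times> {Some True}) \<Longrightarrow> h w = f (realize_map M B fst w)"
    "\<And>w. w \<in> full_subcomplex M leM (B \<times> {Some False}) \<Longrightarrow> h w = g (realize_map M B fst w)"
proof -
  let ?K = "order_complex M leM" and ?F = "full_subcomplex M leM" and ?q = "realize_map M B fst"
  let ?T = "full_subcomplex M leM (B \<times> {Some True})" and ?S = "full_subcomplex M leM (B \<times> {Some False})"
  have fin: "finite M" using B by (simp add: M_def)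
  have fst: "order_preserving M leM B le fst"
    unfolding M_def leM_def by (rule order_preserving_fst)
  note q = continuous_map_realize_map[OF fin B fst]
  have cover: "?F ends = ?T \<union> ?S"
    unfolding M_def leM_def ends_def full_subcomplex_flat_ends by (simp add: UNIV_bool Un_commute)
  have "?T \<inter> ?S = ?F {}"
    unfolding full_subcomplex_Int by (rule arg_cong[where f = ?F]) auto
  then have disjoint: "w \<notin> ?S" if "w \<in> ?T" for w using that by auto
  define h where "h = (\<lambda>w. if w \<in> ?T then f (?q w) else g (?q w))"
  have h: "continuous_map (subtopology ?K (?F ends)) Y h"
    unfolding h_def
  proof (rule continuous_map_closed_pasting[where T = ?S])
    show "closedin (subtopology ?K (?F ends)) ?T" "closedin (subtopology ?K (?F ends)) ?S"
      by (simp_all add: cover closedin_subset_topspace closedin_full_subcomplex)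
    show "continuous_map (subtopology (subtopology ?K (?F ends)) ?T) Y (\<lambda>w. f (?q w))"
      "continuous_map (subtopology (subtopology ?K (?F ends)) ?S) Y (\<lambda>w. g (?q w))"
      using continuous_map_compose[OF q f] continuous_map_compose[OF q g]
      by (simp_all add: o_def continuous_map_from_subtopology)
  qed (use cover disjoint in auto)
  have hC: "h w \<in> C (fst x)" if x: "x \<in> ends" and w: "w \<in> upper_subcomplex M leM x" for x w
  proof -
    have "x \<in> M" "fst x \<in> B" using x by (auto simp: ends_def M_def)
    then show ?thesis
      using realize_map_in_upper_subcomplex[OF fin B fst _ w] carried_onD[OF fC] carried_onD[OF gC]
      by (simp add: h_def)
  qed
  show ?thesis
  proof (rule that[OF h])
    show "h w = f (?q w)" if "w \<in> ?T" for w using that by (simp add: h_def)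
    show "h w = g (?q w)" if "w \<in> ?S" for w using that disjoint by (auto simp: h_def)
  qed (intro carried_onI hC)
qed

theorem carried_maps_homotopic:
  assumes B: "fin_poset B le" and C: "contractible_carrier B le Y C"
    and f: "continuous_map (order_complex B le) Y f" and fC: "carried_on B le B C f"
    and g: "continuous_map (order_complex B le) Y g" and gC: "carried_on B le B C g"
  shows "homotopic_with (\<lambda>x. True) (order_complex B le) Y f g"
proof -
  let ?K = "order_complex B le" and ?M = "B \<times> (UNIV :: bool option set)" and ?leM = "prod_le le flat_le"
  let ?i = "\<lambda>e. realize_map B ?M (\<lambda>b. (b, Some e))" and ?ends = "B \<times> range Some"
  have fin: "finite B" "finite ?M" using fin_poset_finite[OF B] by simp_all
  obtain h
    where h: "continuous_map (subtopology (order_complex ?M ?leM) (full_subcomplex ?M ?leM ?ends)) Y h"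
    and hC: "carried_on ?M ?leM ?ends (\<lambda>x. C (fst x)) h"
    and h_ends: "\<And>w. w \<in> full_subcomplex ?M ?leM (B \<times> {Some True}) \<Longrightarrow> h w = f (realize_map ?M B fst w)"
      "\<And>w. w \<in> full_subcomplex ?M ?leM (B \<times> {Some False}) \<Longrightarrow> h w = g (realize_map ?M B fst w)"
    using carried_maps_on_flat_ends[OF fin(1) f fC g gC] by blast
  have "up_closed ?M ?leM ?ends"
    by (auto simp: up_closed_def up_set_def prod_le_def flat_le_def)
  then obtain H where H: "continuous_map (order_complex ?M ?leM) Y H"
    and H_eq: "\<And>w. w \<in> full_subcomplex ?M ?leM ?ends \<Longrightarrow> H w = h w"
    using carried_extension[OF fin_poset_prod[OF B fin_poset_flat]
        contractible_carrier_order_preserving[OF C order_preserving_fst] _ h hC] by blast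
  have i_in: "?i e w \<in> full_subcomplex ?M ?leM (B \<times> {Some e})" if "w \<in> topspace ?K" for e w
    by (rule realize_map_in_full_subcomplex[OF fin, where U = B])
      (use that in \<open>auto simp: order_preserving_def prod_le_def flat_le_def\<close>)
  have H_i: "(H \<circ> ?i e) w = h (?i e w)" if "w \<in> topspace ?K" for e w
    using H_eq i_in[OF that, of e] full_subcomplex_mono[of "B \<times> {Some e}" ?ends ?M ?leM] by auto
  have q_i: "realize_map ?M B fst (?i e w) = w" if "w \<in> topspace ?K" for e w
    using that by (simp add: realize_map_compose[OF fin] realize_map_ident)
  have "homotopic_with (\<lambda>x. True) ?K Y (H \<circ> ?i True) (H \<circ> ?i False)"
    by (rule homotopic_with_compose_continuous_map_left[OF
          realize_map_flat_inclusions_homotopic[OF B] H]) simp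
  then show ?thesis
    by (rule homotopic_with_eq) (simp_all only: H_i h_ends i_in q_i)
qed

subsection \<open>Quillen's fibre lemma\<close>

theorem quillen_fibre_lemma:
  assumes A: "fin_poset A leA" and B: "fin_poset B leB" and g: "order_preserving A leA B leB g"
    and triv: "\<And>b. b \<in> B \<Longrightarrow> homotopically_trivial {a\<in>A. g a \<in> up_set B leB b} leA"
  shows "weak_equivalence A leA B leB g"
proof -
  let ?KA = "order_complex A leA" and ?KB = "order_complex B leB" and ?g = "realize_map A B g"
  define fibre where "fibre b = full_subcomplex A leA {a\<in>A. g a \<in> up_set B leB b}" for b
  have fin: "finite A" "finite B" using A B by (simp_all add: fin_poset_finite)
  have fibre: "contractible_carrier B leB ?KA fibre"
    unfolding fibre_def using triv up_set_antimono[OF B] fin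
    by (intro contractible_carrier_full_subcomplex) blast+
  obtain k where k: "continuous_map ?KB ?KA k" and k_fibre: "carried_on B leB B fibre k"
    using carried_extension[OF B fibre, of "{}" undefined] by (auto simp: up_closed_def carried_on_def)
  have cont_g: "continuous_map ?KA ?KB ?g" by (rule continuous_map_realize_map[OF fin g])
  have "homotopic_with (\<lambda>x. True) ?KA ?KA (k \<circ> ?g) id"
  proof (rule carried_maps_homotopic[OF A contractible_carrier_order_preserving[OF fibre g]])
    show "carried_on A leA A (\<lambda>a. fibre (g a)) (k \<circ> ?g)"
      unfolding carried_on_def
      using carried_onD[OF k_fibre order_preserving_mem[OF g] realize_map_in_upper_subcomplex[OF fin g]]
      by auto
    have "up_set A leA a \<subseteq> {a'\<in>A. g a' \<in> up_set B leB (g a)}" if "a \<in> A" for a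
      using order_preserving_up_set[OF g that] by (auto simp: up_set_def)
    then show "carried_on A leA A (\<lambda>a. fibre (g a)) id"
      unfolding carried_on_def fibre_def image_id by (auto intro!: full_subcomplex_mono)
  qed (use continuous_map_compose[OF cont_g k] in auto)
  moreover have "homotopic_with (\<lambda>x. True) ?KB ?KB (?g \<circ> k) id"
  proof (rule carried_maps_homotopic[OF B contractible_carrier_upper_subcomplex[OF B]])
    show "carried_on B leB B (upper_subcomplex B leB) (?g \<circ> k)"
      unfolding carried_on_def
      using realize_map_in_full_subcomplex[OF fin g carried_onD[OF k_fibre, unfolded fibre_def]]
      by auto
    show "carried_on B leB B (upper_subcomplex B leB) id" by (simp add: carried_on_def)
  qed (use continuous_map_compose[OF k cont_g] in auto)
  ultimately show ?thesis
    using g cont_g k unfolding weak_equivalence_def homotopy_equivalence_map_def by blast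
qed

subsection \<open>Homotopy colimits of poset diagrams\<close>

lemma
  assumes "poset_diagram Q leQ X leX f"
  shows poset_diagram_poset: "q \<in> Q \<Longrightarrow> fin_poset (X q) (leX q)"
    and poset_diagram_map: "q \<in> Q \<Longrightarrow> q' \<in> Q \<Longrightarrow> leQ q q' \<Longrightarrow>
      order_preserving (X q) (leX q) (X q') (leX q') (f q q')"
    and poset_diagram_ident: "q \<in> Q \<Longrightarrow> x \<in> X q \<Longrightarrow> f q q x = x"
    and poset_diagram_compose: "q \<in> Q \<Longrightarrow> q' \<in> Q \<Longrightarrow> q'' \<in> Q \<Longrightarrow> leQ q q' \<Longrightarrow> leQ q' q'' \<Longrightarrow>
      x \<in> X q \<Longrightarrow> f q' q'' (f q q' x) = f q q'' x"
  using assms unfolding poset_diagram_def by blast+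

lemma poset_diagram_pullback:
  assumes \<phi>: "order_preserving P leP Q leQ \<phi>" and X: "poset_diagram Q leQ X leX f"
  shows "poset_diagram P leP (\<lambda>p. X (\<phi> p)) (\<lambda>p. leX (\<phi> p)) (\<lambda>p p'. f (\<phi> p) (\<phi> p'))"
  using order_preserving_mem[OF \<phi>] order_preserving_le[OF \<phi>] X unfolding poset_diagram_def by meson

lemma hocolim_le_Pair [simp]:
  "hocolim_le leQ leX f (q, x) (q', x') \<longleftrightarrow> leQ q q' \<and> leX q' (f q q' x) x'"
  by (simp add: hocolim_le_def)

lemma hocolim_le_trans:
  assumes Q: "fin_poset Q leQ" and X: "poset_diagram Q leQ X leX f"
    and q: "q \<in> Q" "q' \<in> Q" "q'' \<in> Q" and x: "x \<in> X q" "x' \<in> X q'" "x'' \<in> X q''"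
    and le: "hocolim_le leQ leX f (q, x) (q', x')" "hocolim_le leQ leX f (q', x') (q'', x'')"
  shows "hocolim_le leQ leX f (q, x) (q'', x'')"
proof -
  have leQ: "leQ q q'" "leQ q' q''" and leX: "leX q' (f q q' x) x'" "leX q'' (f q' q'' x') x''"
    using le by simp_all
  have f': "order_preserving (X q) (leX q) (X q') (leX q') (f q q')"
    and f'': "order_preserving (X q') (leX q') (X q'') (leX q'') (f q' q'')"
    using poset_diagram_map[OF X] q leQ by blast+
  have fx: "f q q' x \<in> X q'" using order_preserving_mem[OF f' x(1)] .
  have "leX q'' (f q' q'' (f q q' x)) (f q' q'' x')"
    using order_preserving_le[OF f'' fx x(2) leX(1)] .
  then have "leX q'' (f q' q'' (f q q' x)) x''"
    using fin_poset_trans[OF poset_diagram_poset[OF X q(3)]] leX(2) order_preserving_mem[OF f''] fx x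
    by blast
  then show ?thesis
    using fin_poset_trans[OF Q q leQ] poset_diagram_compose[OF X q leQ x(1)] by simp
qed

lemma hocolim_le_antisym:
  assumes Q: "fin_poset Q leQ" and X: "poset_diagram Q leQ X leX f"
    and q: "q \<in> Q" "q' \<in> Q" and x: "x \<in> X q" "x' \<in> X q'"
    and le: "hocolim_le leQ leX f (q, x) (q', x')" "hocolim_le leQ leX f (q', x') (q, x)"
  shows "(q, x) = (q', x')"
proof -
  have "q = q'" using fin_poset_antisym[OF Q q] le by simp
  with le x show ?thesis
    using fin_poset_antisym[OF poset_diagram_poset[OF X q(1)], of x x']
      poset_diagram_ident[OF X q(1)] by simp
qed

lemma fin_poset_hocolim:
  assumes Q: "fin_poset Q leQ" and X: "poset_diagram Q leQ X leX f"
  shows "fin_poset (hocolim_set Q X) (hocolim_le leQ leX f)"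
  unfolding fin_poset_def hocolim_set_def
proof (intro conjI ballI impI)
  show "finite (Sigma Q X)"
    using fin_poset_finite[OF Q] fin_poset_finite[OF poset_diagram_poset[OF X]] by (rule finite_SigmaI)
  show "hocolim_le leQ leX f a a" if "a \<in> Sigma Q X" for a
    using that fin_poset_refl[OF Q] fin_poset_refl[OF poset_diagram_poset[OF X]]
      poset_diagram_ident[OF X] by (cases a) simp
  show "a = b" if "a \<in> Sigma Q X" "b \<in> Sigma Q X"
    "hocolim_le leQ leX f a b \<and> hocolim_le leQ leX f b a" for a b
    using that hocolim_le_antisym[OF Q X, of "fst a" "fst b" "snd a" "snd b"] by auto
  show "hocolim_le leQ leX f a c" if "a \<in> Sigma Q X" "b \<in> Sigma Q X" "c \<in> Sigma Q X"
    "hocolim_le leQ leX f a b \<and> hocolim_le leQ leX f b c" for a b c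
    using that hocolim_le_trans[OF Q X, of "fst a" "fst b" "fst c" "snd a" "snd b" "snd c"] by auto
qed

lemma order_preserving_hocolim_pullback:
  assumes "order_preserving P leP Q leQ \<phi>"
  shows "order_preserving
    (hocolim_set P (\<lambda>p. X (\<phi> p))) (hocolim_le leP (\<lambda>p. leX (\<phi> p)) (\<lambda>p p'. f (\<phi> p) (\<phi> p')))
    (hocolim_set Q X) (hocolim_le leQ leX f) (\<lambda>(p, x). (\<phi> p, x))"
  unfolding order_preserving_def hocolim_set_def
  using order_preserving_mem[OF assms] order_preserving_le[OF assms] by auto

lemma hocolim_pullback_fibre_iff:
  assumes "order_preserving P leP Q leQ \<phi>"
  shows "(p, y) \<in> {a \<in> hocolim_set P (\<lambda>p. X (\<phi> p)).
      (\<lambda>(p, x). (\<phi> p, x)) a \<in> up_set (hocolim_set Q X) (hocolim_le leQ leX f) (q, x)} \<longleftrightarrow>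
    p \<in> P \<and> y \<in> X (\<phi> p) \<and> leQ q (\<phi> p) \<and> leX (\<phi> p) (f q (\<phi> p) x) y"
  using order_preserving_mem[OF assms(1)] by (auto simp: hocolim_set_def up_set_def)

lemma homotopically_trivial_hocolim_pullback_fibre:
  assumes P: "fin_poset P leP" and Q: "fin_poset Q leQ"
    and \<phi>: "order_preserving P leP Q leQ \<phi>" and X: "poset_diagram Q leQ X leX f"
    and q: "q \<in> Q" and x: "x \<in> X q"
    and triv: "homotopically_trivial {p\<in>P. \<phi> p \<in> up_set Q leQ q} leP"
  shows "homotopically_trivial
    {a \<in> hocolim_set P (\<lambda>p. X (\<phi> p)).
      (\<lambda>(p, x). (\<phi> p, x)) a \<in> up_set (hocolim_set Q X) (hocolim_le leQ leX f) (q, x)}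
    (hocolim_le leP (\<lambda>p. leX (\<phi> p)) (\<lambda>p p'. f (\<phi> p) (\<phi> p')))"
    (is "homotopically_trivial ?D ?leD")
proof -
  let ?E = "{p\<in>P. \<phi> p \<in> up_set Q leQ q}"
  define push where "push p = (p, f q (\<phi> p) x)" for p
  note \<phi>_mem = order_preserving_mem[OF \<phi>] and \<phi>_le = order_preserving_le[OF \<phi>]
  note D_iff = hocolim_pullback_fibre_iff[OF \<phi>, where X = X and leX = leX and f = f and q = q and x = x]
  have E_iff: "p \<in> ?E \<longleftrightarrow> p \<in> P \<and> leQ q (\<phi> p)" for p
    using \<phi>_mem by (auto simp: up_set_def)
  have fx: "f q r x \<in> X r" if "r \<in> Q" "leQ q r" for r
    using order_preserving_mem[OF poset_diagram_map[OF X q that] x] .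
  have X_refl: "leX r y y" if "r \<in> Q" "y \<in> X r" for r y
    using fin_poset_refl[OF poset_diagram_poset[OF X that(1)] that(2)] .
  show ?thesis
  proof (rule homotopically_trivial_galois[where l = push and r = fst])
    show "fin_poset ?E leP" by (rule fin_poset_subset[OF P]) auto
    show "fin_poset ?D ?leD"
      by (rule fin_poset_subset[OF fin_poset_hocolim[OF P poset_diagram_pullback[OF \<phi> X]]]) auto
    show "order_preserving ?E leP ?D ?leD push"
      unfolding order_preserving_def
    proof (intro conjI ballI impI)
      show "push p \<in> ?D" if "p \<in> ?E" for p
        using that \<phi>_mem fx X_refl unfolding push_def D_iff E_iff by blast
      show "?leD (push p) (push p')" if "p \<in> ?E" "p' \<in> ?E" "leP p p'" for p p'
        using that \<phi>_mem \<phi>_le fx X_refl poset_diagram_compose[OF X q _ _ _ _ x, of "\<phi> p" "\<phi> p'"]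
        unfolding E_iff push_def by simp
    qed
    show "order_preserving ?D ?leD ?E leP fst"
      unfolding order_preserving_def using D_iff E_iff by auto
    show "leP p (fst (push p))" if "p \<in> ?E" for p
      using that fin_poset_refl[OF P] by (simp add: push_def)
    show "?leD (push (fst d)) d" if "d \<in> ?D" for d
    proof -
      obtain p y where d: "d = (p, y)" by (cases d)
      with that have "p \<in> P" "leQ q (\<phi> p)" "leX (\<phi> p) (f q (\<phi> p) x) y"
        using D_iff by blast+
      then show ?thesis
        using fin_poset_refl[OF P] poset_diagram_ident[OF X \<phi>_mem fx[OF \<phi>_mem]] by (simp add: d push_def)
    qed
  qed (rule triv)
qed

theorem theorem2p12:
  fixes P :: "'p set" and leP :: "'p \<Rightarrow> 'p \<Rightarrow> bool"
    and Q :: "'q set" and leQ :: "'q \<Rightarrow> 'q \<Rightarrow> bool"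
    and \<phi> :: "'p \<Rightarrow> 'q"
    and X :: "'q \<Rightarrow> 'x set" and leX :: "'q \<Rightarrow> 'x \<Rightarrow> 'x \<Rightarrow> bool"
    and f :: "'q \<Rightarrow> 'q \<Rightarrow> 'x \<Rightarrow> 'x"
  assumes "fin_poset P leP" and "fin_poset Q leQ"
    and "order_preserving P leP Q leQ \<phi>"
    and "poset_diagram Q leQ X leX f"
    and "\<forall>q\<in>Q. homotopically_trivial {p\<in>P. \<phi> p \<in> up_set Q leQ q} leP"
  shows "weak_equivalence
           (hocolim_set P (\<lambda>p. X (\<phi> p)))
           (hocolim_le leP (\<lambda>p. leX (\<phi> p)) (\<lambda>p p'. f (\<phi> p) (\<phi> p')))
           (hocolim_set Q X) (hocolim_le leQ leX f)
           (\<lambda>(p, x). (\<phi> p, x))"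
proof (rule quillen_fibre_lemma)
  show "fin_poset (hocolim_set P (\<lambda>p. X (\<phi> p)))
      (hocolim_le leP (\<lambda>p. leX (\<phi> p)) (\<lambda>p p'. f (\<phi> p) (\<phi> p')))"
    using fin_poset_hocolim[OF assms(1) poset_diagram_pullback[OF assms(3,4)]] .
  show "fin_poset (hocolim_set Q X) (hocolim_le leQ leX f)"
    using fin_poset_hocolim[OF assms(2,4)] .
  show "order_preserving (hocolim_set P (\<lambda>p. X (\<phi> p)))
      (hocolim_le leP (\<lambda>p. leX (\<phi> p)) (\<lambda>p p'. f (\<phi> p) (\<phi> p')))
      (hocolim_set Q X) (hocolim_le leQ leX f) (\<lambda>(p, x). (\<phi> p, x))"
    using order_preserving_hocolim_pullback[OF assms(3)] .
  fix b assume "b \<in> hocolim_set Q X"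
  then obtain q x where "b = (q, x)" "q \<in> Q" "x \<in> X q" by (auto simp: hocolim_set_def)
  then show "homotopically_trivial
      {a \<in> hocolim_set P (\<lambda>p. X (\<phi> p)).
        (\<lambda>(p, x). (\<phi> p, x)) a \<in> up_set (hocolim_set Q X) (hocolim_le leQ leX f) b}
      (hocolim_le leP (\<lambda>p. leX (\<phi> p)) (\<lambda>p p'. f (\<phi> p) (\<phi> p')))"
    using homotopically_trivial_hocolim_pullback_fibre[OF assms(1-4)] assms(5) by blast
qed

end
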